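(* For every agent $j$, let equilibrium consumption be $$x_j^*=S'_x(Y_{\theta_j}^* )\cdot C_j,\qquad\text{where } Y_{\theta_j}^*\text{ solves } Y_{\theta_j}=\frac{S'_x(Y_{\theta_j})\,\mathcal C_{\theta_j}}{S'_x\!\left(\frac1{Y_{\theta_j}}\right)\mathcal C_{-\theta_j}},$$ viewed as a function of the three quantities $C_j$, $\mathcal C_{\theta_j}$ and $\mathcal C_{-\theta_j}$. Then $x_j^*$ is strictly increasing in $C_j$ and in $\mathcal C_{-\theta_j}$, and strictly decreasing in $\mathcal C_{\theta_j}$ (each time holding the other two quantities fixed).
   Context: Agents $j=1,\dots,J$ have incomes $w_j\in[1,\infty)$ and identities $\theta_j\in\{A,B\}$; $-\theta$ is the identity other than $\theta$; $I(\theta)=\{k:\theta_k=\theta\}$ (both nonempty). $G$ is a non-negative $J\times J$ matrix with zero diagonal, $\widehat G_{jk}=G_{jk}\mathbf 1\{\theta_j=\theta_k\}$, $\beta>0$, $H_{jk}=\frac{\beta w_j}{\beta w_j+1}\widehat G_{jk}$. Centrality is $C_j=\sum_k[(I-H)^{-1}]_{jk}\frac{w_k}{\beta w_k+1}>0$ and group-average centrality is $\mathcal C_\theta=\frac1{|I(\theta)|}\sum_{k\in I(\theta)}C_k$. The largest eigenvalue modulus of $G$ is less than $1$. $S(x,Y)$ is twice continuously differentiable and linear in $x$, so $S'_x=\partial S/\partial x$ is a function of $Y$ only, written $S'_x(Y)$; and $S'_x>0$, $S'_Y>0$, $S''_{xY}<0$ for $x\in[0,X]$, $Y\in[1/Z,Z]$,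 where $X\ge\psi\rho$, $Z\ge\psi(1+\beta)$, $\psi=\max_jC_j$ and $\rho=S'_x\!\left(\frac1{\psi(1+\beta)}\right)<\infty$. Solutions $Y^*_{\theta_j}$ are understood to lie in this interval $[1/Z,Z]$. The comparative statics are a thought experiment in which $C_j,\mathcal C_{\theta_j},\mathcal C_{-\theta_j}$ are treated as separately variable positive numbers. *)

theory Defs
  imports "HOL-Analysis.Derivative"
    "Jordan_Normal_Form.Gauss_Jordan_Elimination"
    "Jordan_Normal_Form.Spectral_Radius"
begin

text \<open>Agents are the indices \<open>j < J\<close>; matrices are \<open>J \<times> J\<close> real matrices with 0-based indices.\<close>

datatype identity = TypeA | TypeB

fun opposite :: "identity \<Rightarrow> identity" where
  "opposite TypeA = TypeB"
| "opposite TypeB = TypeA"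

definition group_members :: "nat \<Rightarrow> (nat \<Rightarrow> identity) \<Rightarrow> identity \<Rightarrow> nat set" where
  "group_members J \<theta> t = {k. k < J \<and> \<theta> k = t}"

definition ingroup_mat :: "nat \<Rightarrow> (nat \<Rightarrow> identity) \<Rightarrow> real mat \<Rightarrow> real mat" where
  "ingroup_mat J \<theta> G = mat J J (\<lambda>(j, k). if \<theta> j = \<theta> k then G $$ (j, k) else 0)"

definition H_mat :: "nat \<Rightarrow> real \<Rightarrow> (nat \<Rightarrow> real) \<Rightarrow> (nat \<Rightarrow> identity) \<Rightarrow> real mat \<Rightarrow> real mat" where
  "H_mat J \<beta> w \<theta> G =
     mat J J (\<lambda>(j, k). \<beta> * w j / (\<beta> * w j + 1) * ingroup_mat J \<theta> G $$ (j, k))"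

text \<open>\<open>mat_inverse\<close> returns an option. If \<open>G\<close> is non-negative with spectral radius
  below 1 and \<open>\<beta> > 0\<close>, \<open>w > 0\<close>, then \<open>1 - H\<close> is invertible, so \<open>the\<close> is not applied to \<open>None\<close>.\<close>

definition centrality ::
  "nat \<Rightarrow> real \<Rightarrow> (nat \<Rightarrow> real) \<Rightarrow> (nat \<Rightarrow> identity) \<Rightarrow> real mat \<Rightarrow> nat \<Rightarrow> real" where
  "centrality J \<beta> w \<theta> G j =
     (\<Sum>k<J. the (mat_inverse (1\<^sub>m J - H_mat J \<beta> w \<theta> G)) $$ (j, k) * (w k / (\<beta> * w k + 1)))"

definition group_centrality ::
  "nat \<Rightarrow> real \<Rightarrow> (nat \<Rightarrow> real) \<Rightarrow> (nat \<Rightarrow> identity) \<Rightarrow> real mat \<Rightarrow> identity \<Rightarrow> real" where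
  "group_centrality J \<beta> w \<theta> G t =
     (\<Sum>k\<in>group_members J \<theta> t. centrality J \<beta> w \<theta> G k) / real (card (group_members J \<theta> t))"

definition max_centrality ::
  "nat \<Rightarrow> real \<Rightarrow> (nat \<Rightarrow> real) \<Rightarrow> (nat \<Rightarrow> identity) \<Rightarrow> real mat \<Rightarrow> real" where
  "max_centrality J \<beta> w \<theta> G = Max (centrality J \<beta> w \<theta> G ` {..<J})"

definition dx :: "(real \<Rightarrow> real \<Rightarrow> real) \<Rightarrow> real \<Rightarrow> real \<Rightarrow> real" where
  "dx S x Y = deriv (\<lambda>x'. S x' Y) x"

definition dY :: "(real \<Rightarrow> real \<Rightarrow> real) \<Rightarrow> real \<Rightarrow> real \<Rightarrow> real" where
  "dY S x Y = deriv (\<lambda>Y'. S x Y') Y"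

text \<open>The next two definitions are meant for open \<open>U\<close>.\<close>

definition C1_on :: "(real \<times> real) set \<Rightarrow> (real \<Rightarrow> real \<Rightarrow> real) \<Rightarrow> bool" where
  "C1_on U S \<longleftrightarrow>
     (\<forall>(x, Y)\<in>U. (\<lambda>x'. S x' Y) differentiable (at x) \<and> (\<lambda>Y'. S x Y') differentiable (at Y)) \<and>
     continuous_on U (\<lambda>(x, Y). dx S x Y) \<and> continuous_on U (\<lambda>(x, Y). dY S x Y)"

definition C2_on :: "(real \<times> real) set \<Rightarrow> (real \<Rightarrow> real \<Rightarrow> real) \<Rightarrow> bool" where
  "C2_on U S \<longleftrightarrow> C1_on U S \<and> C1_on U (dx S) \<and> C1_on U (dY S)"

text \<open>Linear in \<open>x\<close> means of degree at most one, with an intercept depending on \<open>Y\<close>.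
  Without the intercept, \<open>\<partial>S/\<partial>Y\<close> would vanish at \<open>x = 0\<close>, contradicting \<open>\<partial>S/\<partial>Y > 0\<close>.\<close>

definition linear_in_x_on :: "(real \<times> real) set \<Rightarrow> (real \<Rightarrow> real \<Rightarrow> real) \<Rightarrow> bool" where
  "linear_in_x_on U S \<longleftrightarrow> (\<exists>p q. \<forall>(x, Y)\<in>U. S x Y = p Y + x * q Y)"

text \<open>For \<open>S\<close> linear in \<open>x\<close>, \<open>\<partial>S/\<partial>x\<close> does not depend on \<open>x\<close>; it is read off at \<open>x = 0\<close>.\<close>

definition Sx :: "(real \<Rightarrow> real \<Rightarrow> real) \<Rightarrow> real \<Rightarrow> real" where
  "Sx S Y = dx S 0 Y"

text \<open>In the following, \<open>c\<close>, \<open>a\<close>, \<open>b\<close> stand for an agent's own centrality, the average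
  centrality of the agent's group, and that of the other group.\<close>

definition solves_Y :: "(real \<Rightarrow> real \<Rightarrow> real) \<Rightarrow> real \<Rightarrow> real \<Rightarrow> real \<Rightarrow> real \<Rightarrow> bool" where
  "solves_Y S Z a b Y \<longleftrightarrow> Y \<in> {1 / Z..Z} \<and> Y = (Sx S Y * a) / (Sx S (1 / Y) * b)"

definition Y_star :: "(real \<Rightarrow> real \<Rightarrow> real) \<Rightarrow> real \<Rightarrow> real \<Rightarrow> real \<Rightarrow> real" where
  "Y_star S Z a b = (THE Y. solves_Y S Z a b Y)"

definition x_star :: "(real \<Rightarrow> real \<Rightarrow> real) \<Rightarrow> real \<Rightarrow> real \<Rightarrow> real \<Rightarrow> real \<Rightarrow> real" where
  "x_star S Z c a b = Sx S (Y_star S Z a b) * c"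

text \<open>The domain of \<open>x_star\<close>: an extreme ratio \<open>a / b\<close> may have no solution in \<open>{1 / Z..Z}\<close>.\<close>

definition x_star_domain :: "(real \<Rightarrow> real \<Rightarrow> real) \<Rightarrow> real \<Rightarrow> (real \<times> real \<times> real) set" where
  "x_star_domain S Z = {(c, a, b). 0 < c \<and> 0 < a \<and> 0 < b \<and> (\<exists>Y. solves_Y S Z a b Y)}"

end

(* On [1/Z, Z] the function Sx is positive and strictly decreasing, so Y * Sx (1/Y) / Sx Y is
   strictly increasing and equals a / b at the solution: Y* is strictly increasing in a / b, and
   x* = c * Sx Y* moves the other way. By the intermediate value theorem a solution exists as soon
   as both group averages a, b satisfy a <= Z b and b <= Z a. For the actual centralities this
   follows from 1 / (1 + \<beta>) <= C j <= \<psi>. The lower bound holds because C = u + H C with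
   u >= 1 / (1 + \<beta>): the negative part f of C satisfies f <= H f <= G f, and such an f vanishes
   since the powers of G tend to 0. The same principle gives the invertibility of 1 - H. *)

theory Submission
  imports Defs
begin

section \<open>Non-negative matrices with spectral radius below 1\<close>

text \<open>An eigenvalue \<open>k\<close> of \<open>G / s\<close> yields the eigenvalue
  \<open>s * k\<close> of \<open>G\<close>, whose modulus is below \<open>s\<close>. The rescaling
  leaves room for a geometric factor in the decay of the powers of \<open>G\<close>.\<close>

lemma spectral_radius_scaled_less_1:
  fixes G :: "real mat"
  assumes G: "G \<in> carrier_mat n n" and n: "0 < n"
    and s: "0 < s" and sr: "spectral_radius (map_mat complex_of_real G) < s"
  shows "spectral_radius (map_mat complex_of_real ((1 / s) \<cdot>\<^sub>m G)) < 1"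
proof -
  let ?G = "map_mat complex_of_real G"
  let ?M = "map_mat complex_of_real ((1 / s) \<cdot>\<^sub>m G)"
  have Gc: "?G \<in> carrier_mat n n" and Mc: "?M \<in> carrier_mat n n"
    using G by auto
  have GM: "?G = complex_of_real s \<cdot>\<^sub>m ?M"
    using s G by (intro eq_matI) auto
  from spectral_radius_mem_max(1)[OF Mc n] obtain k
    where k: "eigenvalue ?M k" and sk: "spectral_radius ?M = norm k"
    unfolding spectrum_def by auto
  from k obtain v where v: "v \<in> carrier_vec n" "v \<noteq> 0\<^sub>v n" "?M *\<^sub>v v = k \<cdot>\<^sub>v v"
    unfolding eigenvalue_def eigenvector_def using G by auto
  have "?G *\<^sub>v v = complex_of_real s \<cdot>\<^sub>v (?M *\<^sub>v v)"
    unfolding GM using v(1) Mc by (intro eq_vecI) auto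
  also have "\<dots> = (complex_of_real s * k) \<cdot>\<^sub>v v"
    unfolding v(3) by (simp add: smult_smult_assoc)
  finally have "eigenvalue ?G (complex_of_real s * k)"
    unfolding eigenvalue_def eigenvector_def using v G by auto
  hence "norm (complex_of_real s * k) \<le> spectral_radius ?G"
    by (intro spectral_radius_mem_max(2)[OF Gc n]) (auto simp: spectrum_def)
  hence "s * norm k \<le> spectral_radius ?G"
    using s by (simp add: norm_mult)
  hence "s * norm k < s" using sr by linarith
  thus ?thesis
    using s sk by simp
qed

lemma nonneg_mat_pow:
  fixes M :: "real mat"
  assumes M: "M \<in> carrier_mat n n" and nn: "\<And>i j. i < n \<Longrightarrow> j < n \<Longrightarrow> 0 \<le> M $$ (i, j)"
  shows "i < n \<Longrightarrow> j < n \<Longrightarrow> 0 \<le> (M ^\<^sub>m k) $$ (i, j)"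
proof (induction k arbitrary: i j)
  case 0
  then show ?case using M by simp
next
  case (Suc k)
  have P: "M ^\<^sub>m k \<in> carrier_mat n n" using M by simp
  show ?case
    using Suc M P nn by (auto simp: scalar_prod_def intro!: sum_nonneg mult_nonneg_nonneg)
qed

text \<open>Iterating \<open>sub\<close> bounds \<open>f\<close> by the m-th power of
  \<open>G\<close> applied to \<open>f\<close>. That power is \<open>s ^ m\<close> times the m-th
  power of \<open>M = G / s\<close>, whose entries stay bounded, so for \<open>s < 1\<close> the
  bound tends to 0.\<close>

lemma nonneg_subinvariant_eq_0:
  fixes G :: "real mat"
  assumes G: "G \<in> carrier_mat n n"
    and nn: "\<And>i j. i < n \<Longrightarrow> j < n \<Longrightarrow> 0 \<le> G $$ (i, j)"
    and sr: "spectral_radius (map_mat complex_of_real G) < 1"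
    and f0: "\<And>i. i < n \<Longrightarrow> 0 \<le> f i"
    and sub: "\<And>i. i < n \<Longrightarrow> f i \<le> (\<Sum>j<n. G $$ (i, j) * f j)"
    and i: "i < n"
  shows "f i = 0"
proof -
  have n: "0 < n" using i by simp
  \<comment> \<open>Above the spectral radius, so that \<open>G / s\<close> still has radius below
    1; below 1, so that \<open>s ^ k\<close> tends to 0; the \<open>max 0\<close> makes division by
    \<open>s\<close> legitimate.\<close>
  obtain s where s: "max 0 (spectral_radius (map_mat complex_of_real G)) < s" "s < 1"
    using dense[of "max 0 (spectral_radius (map_mat complex_of_real G))" 1] sr by auto
  define M where "M = (1 / s) \<cdot>\<^sub>m G"
  have M: "M \<in> carrier_mat n n" using G unfolding M_def by simp
  have Mnn: "0 \<le> M $$ (i, j)" if "i < n" "j < n" for i j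
    using that nn[OF that] s G unfolding M_def by simp
  have "spectral_radius (map_mat complex_of_real M) < 1"
    unfolding M_def using spectral_radius_scaled_less_1[OF G n] s by simp
  \<comment> \<open>The constant \<open>c\<close> bounds the entries of all powers at once.\<close>
  from spectral_radius_jnf_norm_bound_less_1_upper_triangular[OF _ this, of n] M
  obtain c where c: "norm_bound (map_mat complex_of_real M ^\<^sub>m k) c" for k
    by auto
  have bound: "(M ^\<^sub>m k) $$ (i, j) \<le> c" if "i < n" "j < n" for i j k
  proof -
    have "map_mat complex_of_real (M ^\<^sub>m k) = map_mat complex_of_real M ^\<^sub>m k"
      by (rule of_real_hom.mat_hom_pow[OF M])
    hence "norm_bound (map_mat complex_of_real (M ^\<^sub>m k)) c" using c[of k] by simp
    hence "norm (map_mat complex_of_real (M ^\<^sub>m k) $$ (i, j)) \<le> c"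
      using that M unfolding norm_bound_def by simp
    thus ?thesis using that M by simp
  qed
  have iter: "f i \<le> s ^ k * (\<Sum>j<n. (M ^\<^sub>m k) $$ (i, j) * f j)" if i: "i < n" for i k
  proof (induction k)
    case 0
    have "(\<Sum>j<n. (1\<^sub>m n) $$ (i, j) * f j) = (\<Sum>j<n. if j = i then f j else 0)"
      using i by (intro sum.cong) auto
    then show ?case using i M by simp
  next
    case (Suc k)
    let ?P = "M ^\<^sub>m k"
    have P: "?P \<in> carrier_mat n n" using M by simp
    \<comment> \<open>In terms of \<open>M\<close> the hypothesis gains a factor \<open>s\<close>;
      the entries of \<open>?P\<close> are non-negative, so it may be inserted under the
      sum.\<close>
    have step: "f j \<le> s * (\<Sum>l<n. M $$ (j, l) * f l)" if "j < n" for j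
      using sub[OF that] that s G unfolding M_def by (simp add: sum_distrib_left)
    have "(\<Sum>j<n. ?P $$ (i, j) * f j) \<le> (\<Sum>j<n. ?P $$ (i, j) * (s * (\<Sum>l<n. M $$ (j, l) * f l)))"
      using nonneg_mat_pow[OF M Mnn i] step by (intro sum_mono mult_left_mono) auto
    also have "\<dots> = s * (\<Sum>j<n. \<Sum>l<n. ?P $$ (i, j) * M $$ (j, l) * f l)"
      by (simp add: sum_distrib_left mult_ac)
    also have "(\<Sum>j<n. \<Sum>l<n. ?P $$ (i, j) * M $$ (j, l) * f l)
        = (\<Sum>l<n. \<Sum>j<n. ?P $$ (i, j) * M $$ (j, l) * f l)"
      by (rule sum.swap)
    also have "\<dots> = (\<Sum>l<n. (?P * M) $$ (i, l) * f l)"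
      using i P M by (intro sum.cong)
        (auto simp: scalar_prod_def sum_distrib_right atLeast0LessThan)
    finally have "s ^ k * (\<Sum>j<n. ?P $$ (i, j) * f j) \<le> s ^ k * (s * (\<Sum>l<n. (?P * M) $$ (i, l) * f l))"
      using s by (intro mult_left_mono) auto
    with Suc show ?case by (simp add: mult_ac)
  qed
  have "f i \<le> s ^ k * (c * (\<Sum>j<n. f j))" for k
  proof -
    have "(\<Sum>j<n. (M ^\<^sub>m k) $$ (i, j) * f j) \<le> (\<Sum>j<n. c * f j)"
      using bound[OF i] f0 by (intro sum_mono mult_right_mono) auto
    hence "s ^ k * (\<Sum>j<n. (M ^\<^sub>m k) $$ (i, j) * f j) \<le> s ^ k * (\<Sum>j<n. c * f j)"
      using s by (intro mult_left_mono) auto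
    with iter[OF i, of k] show ?thesis by (simp add: sum_distrib_left)
  qed
  moreover have "(\<lambda>k. s ^ k * (c * (\<Sum>j<n. f j))) \<longlonglongrightarrow> 0 * (c * (\<Sum>j<n. f j))"
    using s by (intro tendsto_mult tendsto_const LIMSEQ_realpow_zero) auto
  ultimately have "f i \<le> 0 * (c * (\<Sum>j<n. f j))"
    by (intro LIMSEQ_le_const) auto
  thus ?thesis using f0[OF i] by simp
qed

section \<open>Invertibility of \<open>1 - H\<close> and a lower bound for centrality\<close>

text \<open>The kernel of \<open>1 - H\<close> consists of the fixed vectors of \<open>H\<close>, so
  the determinant is nonzero. The product with \<open>N\<close> on the right is what turns
  \<open>C = N u\<close> into \<open>C - H C = u\<close>.\<close>

lemma mat_inverse_one_minus:
  fixes H :: "real mat"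
  assumes H: "H \<in> carrier_mat n n"
    and fix0: "\<And>v. v \<in> carrier_vec n \<Longrightarrow> H *\<^sub>v v = v \<Longrightarrow> v = 0\<^sub>v n"
  obtains N where "mat_inverse (1\<^sub>m n - H) = Some N" "N \<in> carrier_mat n n"
    "(1\<^sub>m n - H) * N = 1\<^sub>m n"
proof -
  let ?A = "1\<^sub>m n - H"
  have A: "?A \<in> carrier_mat n n" using H by (intro minus_carrier_mat)
  have "det ?A \<noteq> 0"
  proof
    assume "det ?A = 0"
    then obtain v where v: "v \<in> carrier_vec n" "v \<noteq> 0\<^sub>v n" "?A *\<^sub>v v = 0\<^sub>v n"
      using det_0_iff_vec_prod_zero_field[OF A] by auto
    have "?A *\<^sub>v v = v - H *\<^sub>v v"
      using minus_mult_distrib_mat_vec[OF _ H v(1), of "1\<^sub>m n"] v(1) by simp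
    with v(3) have e: "v - H *\<^sub>v v = 0\<^sub>v n" by simp
    have "H *\<^sub>v v = v"
    proof (rule eq_vecI)
      fix i assume "i < dim_vec v"
      hence i: "i < n" using v by simp
      have "(v - H *\<^sub>v v) $ i = 0" using e i by simp
      thus "(H *\<^sub>v v) $ i = v $ i" using i H by simp
    qed (use H v in auto)
    from fix0[OF v(1) this] v(2) show False by simp
  qed
  \<comment> \<open>The \<open>()\<close> fills the free record slot of the matrix ring whose units
    are meant.\<close>
  from det_non_zero_imp_unit[OF A this, of "()"]
  have "mat_inverse ?A \<noteq> None" using mat_inverse(1)[OF A, of "()"] by blast
  then obtain N where N: "mat_inverse ?A = Some N" by auto
  from mat_inverse(2)[OF A N] that[OF N] show thesis by simp
qed

text \<open>Matches the bound \<open>\<psi> * (1 + \<beta>) \<le> Z\<close>: together they keep the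
  ratio of the two group averages within \<open>Z\<close>.\<close>

lemma centrality_ge:
  fixes G :: "real mat"
  assumes w: "\<And>j. j < n \<Longrightarrow> 1 \<le> w j"
    and G: "G \<in> carrier_mat n n"
    and nn: "\<And>i j. i < n \<Longrightarrow> j < n \<Longrightarrow> 0 \<le> G $$ (i, j)"
    and sr: "spectral_radius (map_mat complex_of_real G) < 1"
    and \<beta>: "0 < \<beta>" and j: "j < n"
  shows "1 / (1 + \<beta>) \<le> centrality n \<beta> w \<theta> G j"
proof -
  define H where "H = H_mat n \<beta> w \<theta> G"
  define C where "C = centrality n \<beta> w \<theta> G"
  define u where "u k = w k / (\<beta> * w k + 1)" for k
  have H: "H \<in> carrier_mat n n" unfolding H_def H_mat_def by simp
  have H0: "0 \<le> H $$ (i, k)" and HG: "H $$ (i, k) \<le> G $$ (i, k)"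
    if "i < n" "k < n" for i k
  proof -
    \<comment> \<open>\<open>H\<close> arises from \<open>G\<close> by deleting cross-group entries
      and scaling rows by factors in [0, 1], hence lies entrywise between 0 and
      \<open>G\<close>.\<close>
    have q: "0 \<le> \<beta> * w i / (\<beta> * w i + 1)" "\<beta> * w i / (\<beta> * w i + 1) \<le> 1"
      using \<beta> w[OF that(1)] by (auto simp: divide_le_eq add_nonneg_pos)
    show "0 \<le> H $$ (i, k)"
      using that mult_nonneg_nonneg[OF q(1) nn[OF that]]
      unfolding H_def H_mat_def ingroup_mat_def by simp
    show "H $$ (i, k) \<le> G $$ (i, k)"
      using that q mult_right_mono[OF q(2) nn[OF that]] nn[OF that]
      unfolding H_def H_mat_def ingroup_mat_def by auto
  qed
  have H_mult: "(H *\<^sub>v v) $ i = (\<Sum>k<n. H $$ (i, k) * v $ k)"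
    if "v \<in> carrier_vec n" "i < n" for v i
    using that H by (auto simp: scalar_prod_def atLeast0LessThan)
  have sub0: "f i = 0" if f0: "\<And>i. i < n \<Longrightarrow> 0 \<le> f i"
    and sub: "\<And>i. i < n \<Longrightarrow> f i \<le> (\<Sum>k<n. H $$ (i, k) * f k)" and i: "i < n" for f i
  proof (rule nonneg_subinvariant_eq_0[OF G nn sr f0 _ i])
    fix i assume i: "i < n"
    show "f i \<le> (\<Sum>k<n. G $$ (i, k) * f k)"
      using HG[OF i] f0 by (intro order_trans[OF sub[OF i]] sum_mono mult_right_mono) auto
  qed
  have "v = 0\<^sub>v n" if v: "v \<in> carrier_vec n" "H *\<^sub>v v = v" for v
  proof -
    \<comment> \<open>The triangle inequality makes the absolute values of a fixed vector
      subinvariant under \<open>H\<close>.\<close>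
    have "\<bar>v $ i\<bar> = 0" if i: "i < n" for i
    proof (rule sub0[OF _ _ i])
      fix i assume i: "i < n"
      have "v $ i = (H *\<^sub>v v) $ i" using v by simp
      also have "\<dots> = (\<Sum>k<n. H $$ (i, k) * v $ k)"
        by (rule H_mult[OF v(1) i])
      finally have "\<bar>v $ i\<bar> \<le> (\<Sum>k<n. \<bar>H $$ (i, k) * v $ k\<bar>)"
        using sum_abs[of "\<lambda>k. H $$ (i, k) * v $ k" "{..<n}"] by simp
      also have "\<dots> = (\<Sum>k<n. H $$ (i, k) * \<bar>v $ k\<bar>)"
        using H0[OF i] by (intro sum.cong) (auto simp: abs_mult)
      finally show "\<bar>v $ i\<bar> \<le> (\<Sum>k<n. H $$ (i, k) * \<bar>v $ k\<bar>)" .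
    qed simp
    thus ?thesis using v by (intro eq_vecI) auto
  qed
  from mat_inverse_one_minus[OF H this] obtain N
    where N: "mat_inverse (1\<^sub>m n - H) = Some N" "N \<in> carrier_mat n n" "(1\<^sub>m n - H) * N = 1\<^sub>m n"
    by metis
  have C: "C i = (N *\<^sub>v vec n u) $ i" if "i < n" for i
    using that N(1,2) unfolding C_def centrality_def H_def u_def
    by (auto simp: scalar_prod_def atLeast0LessThan)
  have fixpoint: "C i = u i + (\<Sum>k<n. H $$ (i, k) * C k)" if i: "i < n" for i
  proof -
    let ?x = "N *\<^sub>v vec n u"
    have x: "?x \<in> carrier_vec n" using N by simp
    have "(1\<^sub>m n - H) *\<^sub>v ?x = ((1\<^sub>m n - H) * N) *\<^sub>v vec n u"
      using N(2) H by (intro assoc_mult_mat_vec[symmetric]) auto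
    also have "\<dots> = vec n u" unfolding N(3) by simp
    finally have "?x - H *\<^sub>v ?x = vec n u"
      using minus_mult_distrib_mat_vec[OF _ H x, of "1\<^sub>m n"] x by simp
    hence "(?x - H *\<^sub>v ?x) $ i = u i" using i by simp
    hence "?x $ i - (H *\<^sub>v ?x) $ i = u i" using i H by simp
    thus ?thesis using H_mult[OF x i] C i by simp
  qed
  \<comment> \<open>The map \<open>w / (\<beta> * w + 1)\<close> is increasing in \<open>w\<close>,
    and its value at the least income 1 is \<open>1 / (1 + \<beta>)\<close>.\<close>
  have u: "1 / (1 + \<beta>) \<le> u i" if "i < n" for i
    using w[OF that] \<beta> unfolding u_def by (auto simp: field_simps add_pos_pos)
  have nonneg: "0 \<le> C i" if i: "i < n" for i
  proof -
    \<comment> \<open>As \<open>u\<close> is non-negative, dropping it gives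
      \<open>- C \<le> H (- C)\<close>; enlarging \<open>- C\<close> to its positive part on the
      right keeps the inequality and makes that side non-negative.\<close>
    have "max 0 (- C i) = 0"
    proof (rule sub0[OF _ _ i])
      fix i assume i: "i < n"
      have "- C i \<le> (\<Sum>k<n. H $$ (i, k) * (- C k))"
        using fixpoint[OF i] order_trans[OF _ u[OF i], of 0] \<beta>
        by (simp add: sum_negf)
      also have "\<dots> \<le> (\<Sum>k<n. H $$ (i, k) * max 0 (- C k))"
        using H0[OF i] by (intro sum_mono mult_left_mono) auto
      moreover have "0 \<le> (\<Sum>k<n. H $$ (i, k) * max 0 (- C k))"
        using H0[OF i] by (intro sum_nonneg mult_nonneg_nonneg) auto
      ultimately show "max 0 (- C i) \<le> (\<Sum>k<n. H $$ (i, k) * max 0 (- C k))" by simp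
    qed simp
    thus ?thesis by simp
  qed
  have "0 \<le> (\<Sum>k<n. H $$ (j, k) * C k)"
    using H0[OF j] nonneg by (intro sum_nonneg mult_nonneg_nonneg) auto
  thus ?thesis using fixpoint[OF j] u[OF j] unfolding C_def by simp
qed

lemma mean_bounds:
  fixes f :: "'a \<Rightarrow> real"
  assumes A: "finite A" "A \<noteq> {}" and lo: "\<And>x. x \<in> A \<Longrightarrow> l \<le> f x" and hi: "\<And>x. x \<in> A \<Longrightarrow> f x \<le> h"
  shows "l \<le> sum f A / real (card A)" "sum f A / real (card A) \<le> h"
proof -
  have c: "0 < real (card A)" using A by (simp add: card_gt_0_iff)
  have "real (card A) * l \<le> sum f A" using sum_bounded_below[of A l f] lo by simp
  thus "l \<le> sum f A / real (card A)" using c by (simp add: le_divide_eq mult.commute)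
  have "sum f A \<le> real (card A) * h" using sum_bounded_above[of A f h] hi by simp
  thus "sum f A / real (card A) \<le> h" using c by (simp add: divide_le_eq mult.commute)
qed

section \<open>The equation for \<open>Y\<close> with a positive, decreasing
  \<open>Sx\<close>\<close>

text \<open>Isolates the comparative statics from the network. With \<open>1 \<le> Z\<close> the
  interval is non-empty, and it is closed under \<open>1 / Y\<close>, so \<open>Sx\<close> is
  controlled at both of its arguments in the equation.\<close>

locale decreasing_marginal =
  fixes S :: "real \<Rightarrow> real \<Rightarrow> real" and Z :: real
  assumes Z_ge_1: "1 \<le> Z"
    and pos: "\<And>Y. Y \<in> {1 / Z..Z} \<Longrightarrow> 0 < Sx S Y"
    and cont: "continuous_on {1 / Z..Z} (Sx S)"
    and anti: "\<And>Y Y'. Y \<in> {1 / Z..Z} \<Longrightarrow> Y' \<in> {1 / Z..Z} \<Longrightarrow> Y < Y' \<Longrightarrow> Sx S Y' < Sx S Y"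
begin

lemma inverse_mem: "Y \<in> {1 / Z..Z} \<Longrightarrow> 1 / Y \<in> {1 / Z..Z}"
  and mem_pos: "Y \<in> {1 / Z..Z} \<Longrightarrow> 0 < Y"
proof -
  assume Y: "Y \<in> {1 / Z..Z}"
  have "0 < 1 / Z" using Z_ge_1 by simp
  thus p: "0 < Y" using Y by (simp only: atLeastAtMost_iff) linarith
  show "1 / Y \<in> {1 / Z..Z}"
    using Y p Z_ge_1 by (auto simp: field_simps)
qed

lemma solves_Y_iff:
  assumes "0 < b"
  shows "solves_Y S Z a b Y \<longleftrightarrow> Y \<in> {1 / Z..Z} \<and> Y * Sx S (1 / Y) * b = Sx S Y * a"
proof (cases "Y \<in> {1 / Z..Z}")
  case True
  have "0 < Sx S (1 / Y) * b" using pos[OF inverse_mem[OF True]] assms by simp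
  hence "Y = (Sx S Y * a) / (Sx S (1 / Y) * b) \<longleftrightarrow> Y * (Sx S (1 / Y) * b) = Sx S Y * a"
    by (intro eq_divide_eq[THEN trans]) auto
  thus ?thesis unfolding solves_Y_def using True by (simp add: mult.assoc)
qed (auto simp: solves_Y_def)

lemma lhs_strict_mono:
  assumes "Y \<in> {1 / Z..Z}" "Y' \<in> {1 / Z..Z}" "Y < Y'"
  shows "Y * Sx S (1 / Y) < Y' * Sx S (1 / Y')"
proof -
  have "1 / Y' < 1 / Y" using assms mem_pos by (simp add: frac_less2)
  hence "Sx S (1 / Y) < Sx S (1 / Y')" using anti inverse_mem assms by blast
  thus ?thesis
    using assms mem_pos[OF assms(1)] pos[OF inverse_mem[OF assms(1)]]
    by (intro mult_strict_mono) auto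
qed

text \<open>If \<open>Y' < Y\<close>, the factor \<open>Y * Sx S (1 / Y)\<close> is larger at
  \<open>Y\<close> while \<open>Sx\<close> is smaller there, so the ratio at \<open>Y\<close> would
  be the larger one. Ratios are cross-multiplied; the weak inequality, used in both directions,
  gives uniqueness.\<close>

lemma solution_ratio_mono:
  assumes s: "solves_Y S Z a b Y" "solves_Y S Z a' b' Y'"
    and p: "0 < a" "0 < b" "0 < a'" "0 < b'" and r: "a * b' \<le> a' * b"
  shows "Y \<le> Y'"
proof (rule ccontr)
  assume "\<not> Y \<le> Y'"
  hence lt: "Y' < Y" by simp
  have m: "Y \<in> {1 / Z..Z}" "Y' \<in> {1 / Z..Z}"
    and e: "Y * Sx S (1 / Y) * b = Sx S Y * a" "Y' * Sx S (1 / Y') * b' = Sx S Y' * a'"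
    using s p by (simp_all add: solves_Y_iff)
  have "(Sx S Y' * a') * b = (Y' * Sx S (1 / Y')) * (b * b')"
    using e(2) by (simp add: mult_ac)
  also have "\<dots> < (Y * Sx S (1 / Y)) * (b * b')"
    using lhs_strict_mono[OF m(2,1) lt] p by (intro mult_strict_right_mono) auto
  also have "\<dots> = (Y * Sx S (1 / Y) * b) * b'" by (simp only: mult_ac)
  also have "\<dots> = Sx S Y * (a * b')" using e(1) by simp
  also have "\<dots> \<le> Sx S Y * (a' * b)" using r pos[OF m(1)] by (intro mult_left_mono) auto
  also have "\<dots> < Sx S Y' * (a' * b)"
    using anti[OF m(2,1) lt] p by (intro mult_strict_right_mono) auto
  finally show False by (simp add: mult_ac)
qed

lemma solution_unique:
  assumes "solves_Y S Z a b Y" "solves_Y S Z a b Y'" "0 < a" "0 < b"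
  shows "Y = Y'"
  by (intro antisym solution_ratio_mono[OF assms(1,2,3,4,3,4)]
      solution_ratio_mono[OF assms(2,1,3,4,3,4)] order_refl)

lemma solves_Y_star:
  assumes "(c, a, b) \<in> x_star_domain S Z"
  shows "solves_Y S Z a b (Y_star S Z a b)"
proof -
  from assms obtain Y where Y: "solves_Y S Z a b Y" and p: "0 < a" "0 < b"
    unfolding x_star_domain_def by auto
  show ?thesis
    unfolding Y_star_def by (rule theI[where P = "solves_Y S Z a b", OF Y solution_unique[OF _ Y p]])
qed

text \<open>Strictness: a common solution would force equal ratios, because \<open>Sx\<close> is
  nonzero there.\<close>

lemma Y_star_strict_mono:
  assumes d: "(c, a, b) \<in> x_star_domain S Z" "(c', a', b') \<in> x_star_domain S Z"
    and r: "a * b' < a' * b"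
  shows "Y_star S Z a b < Y_star S Z a' b'"
proof -
  let ?Y = "Y_star S Z a b" and ?Y' = "Y_star S Z a' b'"
  have p: "0 < a" "0 < b" "0 < a'" "0 < b'" using d unfolding x_star_domain_def by auto
  note s = solves_Y_star[OF d(1)] solves_Y_star[OF d(2)]
  have "?Y \<le> ?Y'" using solution_ratio_mono[OF s p] r by simp
  moreover have "?Y \<noteq> ?Y'"
  proof
    assume eq: "?Y = ?Y'"
    have m: "?Y \<in> {1 / Z..Z}" using s(1) unfolding solves_Y_def by simp
    have e: "?Y * Sx S (1 / ?Y) * b = Sx S ?Y * a" "?Y * Sx S (1 / ?Y) * b' = Sx S ?Y * a'"
      using s p eq by (simp_all add: solves_Y_iff)
    have "(Sx S ?Y * a) * b' = (Sx S ?Y * a') * b"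
      unfolding e[symmetric] by (simp add: mult_ac)
    thus False using r pos[OF m] by simp
  qed
  ultimately show ?thesis by simp
qed

text \<open>Stated for ratios so as to serve twice: \<open>b = b'\<close> gives the decrease in
  \<open>a\<close>, and \<open>a = a'\<close> the increase in \<open>b\<close>.\<close>

lemma x_star_less:
  assumes d: "(c, a, b) \<in> x_star_domain S Z" "(c, a', b') \<in> x_star_domain S Z"
    and r: "a * b' < a' * b"
  shows "x_star S Z c a' b' < x_star S Z c a b"
proof -
  have "Y_star S Z a b \<in> {1 / Z..Z}" "Y_star S Z a' b' \<in> {1 / Z..Z}"
    using solves_Y_star[OF d(1)] solves_Y_star[OF d(2)] unfolding solves_Y_def by simp_all
  from anti[OF this Y_star_strict_mono[OF d r]] show ?thesis
    using d unfolding x_star_def x_star_domain_def by simp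
qed

lemma solution_exists:
  assumes a: "0 < a" and b: "0 < b" and ab: "a \<le> Z * b" "b \<le> Z * a"
  shows "\<exists>Y. solves_Y S Z a b Y"
proof -
  define f where "f Y = Y * Sx S (1 / Y) * b - Sx S Y * a" for Y
  have Z: "0 < Z" "1 / Z \<le> Z" using Z_ge_1 by (auto simp: divide_le_eq mult_ge1_I)
  have mem: "Z \<in> {1 / Z..Z}" "1 / Z \<in> {1 / Z..Z}" using Z by auto
  \<comment> \<open>For \<open>Z = 1\<close> the interval is a single point and \<open>anti\<close>
    says nothing, but both sides coincide.\<close>
  have g: "Sx S Z \<le> Sx S (1 / Z)"
    using anti[OF mem(2,1)] Z by (cases "1 / Z = Z") auto
  have "continuous_on {1 / Z..Z} (\<lambda>Y. Sx S (1 / Y))"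
    using inverse_mem mem_pos
    by (intro continuous_on_compose2[OF cont] continuous_intros) force+
  hence "continuous_on {1 / Z..Z} f"
    unfolding f_def by (intro continuous_intros cont)
  \<comment> \<open>Each endpoint sign combines \<open>g\<close> with one of the two ratio bounds:
    \<open>b \<le> Z * a\<close> here, \<open>a \<le> Z * b\<close> at \<open>Z\<close>.\<close>
  moreover have "f (1 / Z) \<le> 0"
  proof -
    have "Sx S Z * b \<le> Sx S (1 / Z) * (Z * a)"
      using g ab(2) b pos[OF mem(2)] by (intro mult_mono) auto
    thus ?thesis unfolding f_def using Z by (simp add: field_simps)
  qed
  moreover have "0 \<le> f Z"
  proof -
    have "Sx S Z * a \<le> Sx S (1 / Z) * (Z * b)"
      using g ab(1) a pos[OF mem(2)] by (intro mult_mono) auto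
    thus ?thesis unfolding f_def by (simp add: mult_ac)
  qed
  ultimately obtain Y where "1 / Z \<le> Y" "Y \<le> Z" "f Y = 0"
    using IVT'[of f "1 / Z" 0 Z] Z by auto
  thus ?thesis using solves_Y_iff[OF b] unfolding f_def by auto
qed

end

text \<open>Two conjuncts guard the meaning of the monotonicity claims: the first shows that the
  slices of the domain through the model's own centralities are non-empty, and uniqueness makes the
  \<open>THE\<close> in \<open>Y_star\<close> an actual solution.\<close>

theorem mainTheorem2:
  fixes J :: nat
    and w :: "nat \<Rightarrow> real"
    and \<theta> :: "nat \<Rightarrow> identity"
    and G :: "real mat"
    and \<beta> X Z \<psi> \<rho> :: real
    and S :: "real \<Rightarrow> real \<Rightarrow> real"
    and U :: "(real \<times> real) set"
    and C :: "nat \<Rightarrow> real"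
    and CC :: "identity \<Rightarrow> real"
  assumes incomes: "\<forall>j<J. 1 \<le> w j"
    and groups_nonempty: "\<forall>t. group_members J \<theta> t \<noteq> {}"
    and G_dim: "G \<in> carrier_mat J J"
    and G_nonneg: "\<forall>j<J. \<forall>k<J. 0 \<le> G $$ (j, k)"
    and G_diag: "\<forall>j<J. G $$ (j, j) = 0"
    and G_radius: "spectral_radius (map_mat complex_of_real G) < 1"
    and beta_pos: "0 < \<beta>"
    and C_eq: "C = centrality J \<beta> w \<theta> G"
    and CC_eq: "CC = group_centrality J \<beta> w \<theta> G"
    and psi_eq: "\<psi> = max_centrality J \<beta> w \<theta> G"
    and U_open: "open U"
    and U_superset: "{0..X} \<times> {1 / Z..Z} \<subseteq> U"
    and S_C2: "C2_on U S"
    and S_linear: "linear_in_x_on U S"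
    and Sx_pos: "\<forall>x\<in>{0..X}. \<forall>Y\<in>{1 / Z..Z}. 0 < dx S x Y"
    and SY_pos: "\<forall>x\<in>{0..X}. \<forall>Y\<in>{1 / Z..Z}. 0 < dY S x Y"
    and SxY_neg: "\<forall>x\<in>{0..X}. \<forall>Y\<in>{1 / Z..Z}. dY (dx S) x Y < 0"
    and rho_eq: "\<rho> = Sx S (1 / (\<psi> * (1 + \<beta>)))"
    and X_nonneg: "0 \<le> X"
    and X_bound: "\<psi> * \<rho> \<le> X"
    and Z_bound: "\<psi> * (1 + \<beta>) \<le> Z"
  shows "\<forall>j<J.
    (C j, CC (\<theta> j), CC (opposite (\<theta> j))) \<in> x_star_domain S Z \<and>
    (\<forall>(c, a, b)\<in>x_star_domain S Z. \<exists>!Y. solves_Y S Z a b Y) \<and>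
    (\<forall>a b. strict_mono_on {c. (c, a, b) \<in> x_star_domain S Z} (\<lambda>c. x_star S Z c a b)) \<and>
    (\<forall>c a. strict_mono_on {b. (c, a, b) \<in> x_star_domain S Z} (\<lambda>b. x_star S Z c a b)) \<and>
    (\<forall>c b. strict_antimono_on {a. (c, a, b) \<in> x_star_domain S Z} (\<lambda>a. x_star S Z c a b))"
proof -
  have C_ge: "1 / (1 + \<beta>) \<le> C j" if "j < J" for j
    unfolding C_eq using that incomes G_nonneg
    by (intro centrality_ge[OF _ G_dim _ G_radius beta_pos]) auto
  have C_le: "C j \<le> \<psi>" if "j < J" for j
    unfolding psi_eq max_centrality_def C_eq using that by (intro Max_ge) auto
  have CC: "1 / (1 + \<beta>) \<le> CC t" "CC t \<le> \<psi>" for t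
  proof -
    have fin: "finite (group_members J \<theta> t)" and ne: "group_members J \<theta> t \<noteq> {}"
      using groups_nonempty by (auto simp: group_members_def)
    have eq: "CC t = sum C (group_members J \<theta> t) / real (card (group_members J \<theta> t))"
      unfolding CC_eq C_eq group_centrality_def by simp
    have "1 / (1 + \<beta>) \<le> C k" "C k \<le> \<psi>" if "k \<in> group_members J \<theta> t" for k
      using that C_ge C_le by (simp_all add: group_members_def)
    from mean_bounds[where f = C, OF fin ne this] show "1 / (1 + \<beta>) \<le> CC t" "CC t \<le> \<psi>"
      unfolding eq by blast+
  qed
  have inv_pos: "0 < 1 / (1 + \<beta>)" using beta_pos by simp
  have psi_ge: "1 / (1 + \<beta>) \<le> \<psi>" using CC order_trans by blast
  have Z_1: "1 \<le> Z"
  proof -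
    have "1 \<le> \<psi> * (1 + \<beta>)" using psi_ge beta_pos by (simp add: divide_le_eq)
    thus ?thesis using Z_bound by simp
  qed
  have ratio: "CC t \<le> Z * CC t'" for t t'
  proof -
    \<comment> \<open>Writing \<open>\<psi>\<close> as this product lets \<open>Z_bound\<close>
      dominate the first factor and the lower bound on averages the second.\<close>
    have "CC t \<le> (\<psi> * (1 + \<beta>)) * (1 / (1 + \<beta>))" using CC(2)[of t] beta_pos by simp
    also have "\<dots> \<le> Z * CC t'"
      using Z_bound CC(1)[of t'] inv_pos Z_1 by (intro mult_mono) auto
    finally show ?thesis .
  qed
  have deriv_neg: "\<exists>d. (Sx S has_real_derivative d) (at Y) \<and> d < 0" if Y: "Y \<in> {1 / Z..Z}" for Y
  proof -
    \<comment> \<open>\<open>Sx\<close> is read off at \<open>x = 0\<close>, which lies in the range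
      of \<open>x\<close> since \<open>0 \<le> X\<close>. The C2 hypothesis makes the mixed
      \<open>deriv\<close> a genuine derivative, so that its sign can be used.\<close>
    have "(0, Y) \<in> U" using U_superset Y X_nonneg by auto
    moreover have "C1_on U (dx S)" using S_C2 unfolding C2_on_def by simp
    ultimately have "(\<lambda>Y'. dx S 0 Y') differentiable (at Y)"
      unfolding C1_on_def by blast
    hence "Sx S differentiable (at Y)" unfolding Sx_def[abs_def] .
    hence "(Sx S has_real_derivative deriv (Sx S) Y) (at Y)"
      by (metis DERIV_imp_deriv real_differentiableE)
    moreover have "deriv (Sx S) Y < 0"
      using SxY_neg Y X_nonneg unfolding dY_def Sx_def[abs_def] by auto
    ultimately show ?thesis by blast
  qed
  interpret decreasing_marginal S Z
  proof
    show "1 \<le> Z" by (rule Z_1)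
    show "0 < Sx S Y" if "Y \<in> {1 / Z..Z}" for Y
      using Sx_pos that X_nonneg unfolding Sx_def by auto
    show "continuous_on {1 / Z..Z} (Sx S)"
      using deriv_neg by (meson DERIV_isCont continuous_at_imp_continuous_on)
    show "Sx S Y' < Sx S Y" if "Y \<in> {1 / Z..Z}" "Y' \<in> {1 / Z..Z}" "Y < Y'" for Y Y'
      using that by (intro DERIV_neg_imp_decreasing[of Y Y' "Sx S"] deriv_neg) auto
  qed
  have dom: "(C j, CC (\<theta> j), CC (opposite (\<theta> j))) \<in> x_star_domain S Z" if "j < J" for j
  proof -
    have "0 < C j" using C_ge[OF that] inv_pos by linarith
    moreover have cp: "0 < CC t" for t using CC(1)[of t] inv_pos by linarith
    ultimately show ?thesis
      unfolding x_star_domain_def using solution_exists[OF cp cp ratio ratio] by simp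
  qed
  have mono_c: "strict_mono_on {c. (c, a, b) \<in> x_star_domain S Z} (\<lambda>c. x_star S Z c a b)" for a b
  proof (rule strict_mono_onI)
    fix c c' assume "c \<in> {c. (c, a, b) \<in> x_star_domain S Z}" "c < c'"
    \<comment> \<open>\<open>Y_star\<close> does not depend on \<open>c\<close>, so
      \<open>x_star\<close> is linear in \<open>c\<close> with this positive slope.\<close>
    moreover from this have "0 < Sx S (Y_star S Z a b)"
      using solves_Y_star pos unfolding solves_Y_def by blast
    ultimately show "x_star S Z c a b < x_star S Z c' a b"
      unfolding x_star_def by simp
  qed
  have mono_b: "strict_mono_on {b. (c, a, b) \<in> x_star_domain S Z} (\<lambda>b. x_star S Z c a b)" for c a
    \<comment> \<open>Positivity of \<open>a\<close> in the domain turns a strict increase of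
      \<open>b\<close> into a strict decrease of the ratio.\<close>
    using x_star_less by (intro strict_mono_onI) (auto simp: x_star_domain_def)
  have anti_a: "strict_antimono_on {a. (c, a, b) \<in> x_star_domain S Z} (\<lambda>a. x_star S Z c a b)" for c b
    using x_star_less by (intro monotone_onI) (auto simp: x_star_domain_def)
  have uniq: "\<exists>!Y. solves_Y S Z a b Y" if "(c, a, b) \<in> x_star_domain S Z" for c a b
    using that solution_unique unfolding x_star_domain_def by blast
  hence "\<forall>(c, a, b)\<in>x_star_domain S Z. \<exists>!Y. solves_Y S Z a b Y" by clarify
  thus ?thesis using dom mono_c mono_b anti_a by simp
qed

end
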